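(* (1) Let $\mathcal G$ be a partial multiaction of a monoid $T$ on a semilattice $E$ with compatible restrictions and corestrictions and assume that for all $c,d\in E\rtimes_{\mathcal G}T$: $c\mathrel{\sigma}d$ holds if and only if $\mathbf l(c)=\mathbf l(d)$. Then $E\rtimes_{\mathcal G}T$ is strictly proper and $(E\rtimes_{\mathcal G}T)/\sigma\simeq T$ via the map $[(e,s,f)]_\sigma\mapsto s$. (2) Let $S$ be a strictly proper Ehresmann semigroup. Then the underlying labelled directed graph $\mathcal G_S$ is a partial multiaction of $S/\sigma$ on $P(S)$.
   Context: **Ehresmann semigroups.** An Ehresmann semigroup is an algebra $(S;\cdot\,,{}^+,{}^* )$ with $(S;\cdot)$ a semigroup and unary operations ${}^+,{}^*$ satisfying $x^+x=x$, $(x^+y^+)^+=x^+y^+=y^+x^+$, $(xy)^+=(xy^+)^+$, $xx^*=x$, $(x^*y^* )^*=x^*y^*=y^*x^*$, $(xy)^*=(x^*y)^*$, $(x^+)^*=x^+$, $(x^* )^+=x^*$. $P(S)=\{s^+\colon s\in S\}=\{s^*\colon s\in S\}$ is the semilattice of projections. $\sigma$ is the minimum congruence on $S$ identifying all elements of $P(S)$; $[a]_\sigma$ is the class of $a$; $S/\sigma$ is a monoid with identity $1$ the common class of projections. $S$ is strictly proper if all its elements are proper, i.e. for all $s,t\in S$: $t^+=s^+$, $t^*=s^*$ and $t\mathrel{\sigma}s$ imply $t=s$. **The graph $\mathcal G_S$.** For a strictly proper $S$, $\mathcal G_S$ has vertex set $P(S)$ and edges $(a^+,[a]_\sigma,a^*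 )$, $a\in S$ (from $a^+$ to $a^*$, labelled by $[a]_\sigma\in S/\sigma$). **Partial multiactions.** A partial multiaction $\mathcal G$ of a monoid $T$ on a non-empty set $X$ is a labelled directed graph with vertex set $X$, given by its edge set $\mathrm E(\mathcal G)\subseteq X\times T\times X$ (the edge $c=(x,t,y)$ has $\mathbf d(c)=x$, $\mathbf r(c)=y$, $\mathbf l(c)=t$), such that $(x,1,x)\in\mathrm E(\mathcal G)$ for all $x\in X$; for each $t\in T$ there is an edge labelled by $t$; and $(x,t,y),(y,s,z)\in\mathrm E(\mathcal G)$ imply $(x,ts,z)\in\mathrm E(\mathcal G)$. It is a category with composition $(x,t,y)(y,s,z)=(x,ts,z)$. **Compatible restrictions and corestrictions.** Let $X=E$ be a semilattice ($e\le f$ iff $ef=e$). $\mathcal G$ has compatible restrictions and corestrictions if for every edge $(e,t,f)$ and $g\le e$ there is given an edge ${}_g|(e,t,f)$, and for every edge $(e,t,f)$ and $h\le f$ an edge $(e,t,f)|_h$, such that: (R1) ${}_g|(e,t,f)=(g,t,f')$ for some $f'\le f$; (R2) ${}_e|(e,t,f)=(e,t,f)$; (R3) if $h\le g\le e$ then ${}_h|({}_g|(e,t,f))={}_h|(e,t,f)$; (R4) if $n\ge2$, $p_i=(e_{i-1},t_i,e_i)\in\mathrm E(\mathcal G)$ for $1\le i\le n$, $(e_0,t_1\cdots t_n,e_n)\in\mathrm E(\mathcal G)$, $e_0'\le e_0$, and $e_i'=\mathbf r({}_{e_{i-1}'}|p_i)$ for $1\le i\le n$, then ${}_{e_0'}|(e_0,t_1\cdots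 t_n,e_n)=(e_0',t_1\cdots t_n,e_n')$; (R5) if $f\le e$ then ${}_f|(e,1,e)=(f,1,f)$; (CR1) $(e,t,f)|_g=(e',t,g)$ for some $e'\le e$; (CR2) $(e,t,f)|_f=(e,t,f)$; (CR3) if $h\le g\le f$ then $((e,t,f)|_g)|_h=(e,t,f)|_h$; (CR4) if $n\ge2$, $p_i=(e_{i-1},t_i,e_i)\in\mathrm E(\mathcal G)$ for $1\le i\le n$, $(e_0,t_1\cdots t_n,e_n)\in\mathrm E(\mathcal G)$, $e_n'\le e_n$, and $e_{i-1}'=\mathbf d(p_i|_{e_i'})$ for $i=n,\dots,1$, then $(e_0,t_1\cdots t_n,e_n)|_{e_n'}=(e_0',t_1\cdots t_n,e_n')$; (CR5) if $f\le e$ then $(e,1,e)|_f=(f,1,f)$; (C) for every $c=(e,t,f)\in\mathrm E(\mathcal G)$, $g\le e$, $h\le f$: $({}_g|c)|_{\mathbf r({}_g|c)h}={}_{\mathbf d(c|_h)g}|(c|_h)=(g\,\mathbf d(c|_h),t,\mathbf r({}_g|c)h)$. **$E\rtimes_{\mathcal G}T$.** For such $\mathcal G$, $E\rtimes_{\mathcal G}T$ is the Ehresmann semigroup with underlying set $\mathrm E(\mathcal G)$ and operations $c\cdot d=(c|_{\mathbf r(c)\mathbf d(d)})({}_{\mathbf r(c)\mathbf d(d)}|d)$ (composition in the category $\mathcal G$ on the right), $c^+=(\mathbf d(c),1,\mathbf d(c))$, $c^*=(\mathbf r(c),1,\mathbf r(c))$. *)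

theory Defs
  imports "HOL-Algebra.Group"
begin

section \<open>Ehresmann semigroups\<close>

no_notation
  trancl (\<open>(\<open>notation=\<open>postfix +\<close>\<close>_\<^sup>+)\<close> [1000] 999) and
  rtrancl (\<open>(\<open>notation=\<open>postfix *\<close>\<close>_\<^sup>*)\<close> [1000] 999)

record 'a biunary = "'a partial_object" +
  bmult :: "'a \<Rightarrow> 'a \<Rightarrow> 'a" (infixl \<open>\<cdot>\<index>\<close> 70)
  bplus :: "'a \<Rightarrow> 'a" (\<open>_\<^sup>+\<index>\<close> [1000] 999)
  bstar :: "'a \<Rightarrow> 'a" (\<open>_\<^sup>*\<index>\<close> [1000] 999)

text \<open>As usual, the underlying set of an algebra is assumed to be non-empty.\<close>

locale ehresmann_semigroup =
  fixes S (structure)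
  assumes nonempty: "carrier S \<noteq> {}"
    and mult_closed: "\<lbrakk>x \<in> carrier S; y \<in> carrier S\<rbrakk> \<Longrightarrow> x \<cdot> y \<in> carrier S"
    and plus_closed: "x \<in> carrier S \<Longrightarrow> x\<^sup>+ \<in> carrier S"
    and star_closed: "x \<in> carrier S \<Longrightarrow> x\<^sup>* \<in> carrier S"
    and assoc: "\<lbrakk>x \<in> carrier S; y \<in> carrier S; z \<in> carrier S\<rbrakk> \<Longrightarrow> (x \<cdot> y) \<cdot> z = x \<cdot> (y \<cdot> z)"
    and plus_left: "x \<in> carrier S \<Longrightarrow> x\<^sup>+ \<cdot> x = x"
    and plus_plus: "\<lbrakk>x \<in> carrier S; y \<in> carrier S\<rbrakk> \<Longrightarrow> (x\<^sup>+ \<cdot> y\<^sup>+)\<^sup>+ = x\<^sup>+ \<cdot> y\<^sup>+"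
    and plus_comm: "\<lbrakk>x \<in> carrier S; y \<in> carrier S\<rbrakk> \<Longrightarrow> x\<^sup>+ \<cdot> y\<^sup>+ = y\<^sup>+ \<cdot> x\<^sup>+"
    and plus_mult: "\<lbrakk>x \<in> carrier S; y \<in> carrier S\<rbrakk> \<Longrightarrow> (x \<cdot> y)\<^sup>+ = (x \<cdot> y\<^sup>+)\<^sup>+"
    and star_right: "x \<in> carrier S \<Longrightarrow> x \<cdot> x\<^sup>* = x"
    and star_star: "\<lbrakk>x \<in> carrier S; y \<in> carrier S\<rbrakk> \<Longrightarrow> (x\<^sup>* \<cdot> y\<^sup>*)\<^sup>* = x\<^sup>* \<cdot> y\<^sup>*"
    and star_comm: "\<lbrakk>x \<in> carrier S; y \<in> carrier S\<rbrakk> \<Longrightarrow> x\<^sup>* \<cdot> y\<^sup>* = y\<^sup>* \<cdot> x\<^sup>*"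
    and star_mult: "\<lbrakk>x \<in> carrier S; y \<in> carrier S\<rbrakk> \<Longrightarrow> (x \<cdot> y)\<^sup>* = (x\<^sup>* \<cdot> y)\<^sup>*"
    and star_of_plus: "x \<in> carrier S \<Longrightarrow> (x\<^sup>+)\<^sup>* = x\<^sup>+"
    and plus_of_star: "x \<in> carrier S \<Longrightarrow> (x\<^sup>*)\<^sup>+ = x\<^sup>*"

definition projections :: "('a, 'm) biunary_scheme \<Rightarrow> 'a set" where
  "projections S = {s\<^sup>+\<^bsub>S\<^esub> | s. s \<in> carrier S}"

definition is_congruence :: "('a, 'm) biunary_scheme \<Rightarrow> 'a rel \<Rightarrow> bool" where
  "is_congruence S \<rho> \<longleftrightarrow>
     equiv (carrier S) \<rho> \<and>
     (\<forall>(a, b) \<in> \<rho>. \<forall>(c, d) \<in> \<rho>. (a \<cdot>\<^bsub>S\<^esub> c, b \<cdot>\<^bsub>S\<^esub> d) \<in> \<rho>) \<and>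
     (\<forall>(a, b) \<in> \<rho>. (a\<^sup>+\<^bsub>S\<^esub>, b\<^sup>+\<^bsub>S\<^esub>) \<in> \<rho>) \<and>
     (\<forall>(a, b) \<in> \<rho>. (a\<^sup>*\<^bsub>S\<^esub>, b\<^sup>*\<^bsub>S\<^esub>) \<in> \<rho>)"

definition sigma :: "('a, 'm) biunary_scheme \<Rightarrow> 'a rel" where
  "sigma S = \<Inter>{\<rho>. is_congruence S \<rho> \<and> projections S \<times> projections S \<subseteq> \<rho>}"

definition sigma_class :: "('a, 'm) biunary_scheme \<Rightarrow> 'a \<Rightarrow> 'a set" where
  "sigma_class S a = sigma S `` {a}"

text \<open>The unit is the common class of all projections, written as a union of equal sets.\<close>

definition sigma_quotient :: "('a, 'm) biunary_scheme \<Rightarrow> 'a set monoid" where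
  "sigma_quotient S =
     \<lparr>carrier = carrier S // sigma S,
      mult = (\<lambda>A B. \<Union>a\<in>A. \<Union>b\<in>B. sigma_class S (a \<cdot>\<^bsub>S\<^esub> b)),
      one = (\<Union>p\<in>projections S. sigma_class S p)\<rparr>"

definition proper :: "('a, 'm) biunary_scheme \<Rightarrow> 'a \<Rightarrow> bool" where
  "proper S s \<longleftrightarrow>
     (\<forall>t\<in>carrier S. t\<^sup>+\<^bsub>S\<^esub> = s\<^sup>+\<^bsub>S\<^esub> \<and> t\<^sup>*\<^bsub>S\<^esub> = s\<^sup>*\<^bsub>S\<^esub> \<and> (t, s) \<in> sigma S \<longrightarrow> t = s)"

locale strictly_proper_ehresmann_semigroup = ehresmann_semigroup +
  assumes all_proper: "s \<in> carrier S \<Longrightarrow> proper S s"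


section \<open>Partial multiactions\<close>

type_synonym ('x, 't) edge = "'x \<times> 't \<times> 'x"

definition src :: "('x, 't) edge \<Rightarrow> 'x" where "src c = fst c"
definition lab :: "('x, 't) edge \<Rightarrow> 't" where "lab c = fst (snd c)"
definition tgt :: "('x, 't) edge \<Rightarrow> 'x" where "tgt c = snd (snd c)"

definition edge_comp :: "('t, 'm) monoid_scheme \<Rightarrow> ('x, 't) edge \<Rightarrow> ('x, 't) edge \<Rightarrow> ('x, 't) edge"
  where "edge_comp T c d = (src c, lab c \<otimes>\<^bsub>T\<^esub> lab d, tgt d)"

locale partial_multiaction = monoid T for T (structure) +
  fixes X :: "'x set" and G :: "('x, 'a) edge set"
  assumes vertices_nonempty: "X \<noteq> {}"
    and edges: "G \<subseteq> X \<times> carrier T \<times> X"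
    and identity_edge: "x \<in> X \<Longrightarrow> (x, \<one>, x) \<in> G"
    and label_occurs: "t \<in> carrier T \<Longrightarrow> \<exists>x y. (x, t, y) \<in> G"
    and edges_compose: "\<lbrakk>(x, t, y) \<in> G; (y, s, z) \<in> G\<rbrakk> \<Longrightarrow> (x, t \<otimes> s, z) \<in> G"

locale semilattice_on =
  fixes E :: "'e set" and wedge :: "'e \<Rightarrow> 'e \<Rightarrow> 'e"
  assumes meet_closed: "\<lbrakk>e \<in> E; f \<in> E\<rbrakk> \<Longrightarrow> wedge e f \<in> E"
    and meet_assoc: "\<lbrakk>e \<in> E; f \<in> E; g \<in> E\<rbrakk> \<Longrightarrow> wedge (wedge e f) g = wedge e (wedge f g)"
    and meet_comm: "\<lbrakk>e \<in> E; f \<in> E\<rbrakk> \<Longrightarrow> wedge e f = wedge f e"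
    and meet_idem: "e \<in> E \<Longrightarrow> wedge e e = e"

definition (in semilattice_on) below :: "'e \<Rightarrow> 'e \<Rightarrow> bool" (infix \<open>\<preceq>\<close> 50) where
  "e \<preceq> f \<longleftrightarrow> e \<in> E \<and> f \<in> E \<and> wedge e f = e"

text \<open>\<open>t\<^sub>1 \<cdots> t\<^sub>n\<close> as a right-nested product; \<open>T\<close> need not be commutative.\<close>

definition word_prod :: "('t, 'm) monoid_scheme \<Rightarrow> (nat \<Rightarrow> 't) \<Rightarrow> nat \<Rightarrow> 't" where
  "word_prod T t n = foldr (\<lambda>i p. t i \<otimes>\<^bsub>T\<^esub> p) [1..<Suc n] \<one>\<^bsub>T\<^esub>"

text \<open>
  \<open>res g c\<close> is the restriction of the edge \<open>c\<close> to \<open>g\<close> and \<open>cor c h\<close> its corestriction to \<open>h\<close>.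
  These are total functions, constrained only for \<open>c \<in> G\<close>, \<open>g \<preceq> src c\<close> and \<open>h \<preceq> tgt c\<close>.
\<close>

locale compatible_multiaction =
  partial_multiaction T E G + semilattice_on E wedge
  for T (structure) and E :: "'e set" and G and wedge (infixl \<open>\<^bold>\<sqinter>\<close> 70) +
  fixes res :: "'e \<Rightarrow> ('e, 'a) edge \<Rightarrow> ('e, 'a) edge"
    and cor :: "('e, 'a) edge \<Rightarrow> 'e \<Rightarrow> ('e, 'a) edge"
  assumes res_edge: "\<lbrakk>c \<in> G; g \<preceq> src c\<rbrakk> \<Longrightarrow> res g c \<in> G"
    and cor_edge: "\<lbrakk>c \<in> G; h \<preceq> tgt c\<rbrakk> \<Longrightarrow> cor c h \<in> G"
    and R1: "\<lbrakk>(e, t, f) \<in> G; g \<preceq> e\<rbrakk> \<Longrightarrow> \<exists>f'. f' \<preceq> f \<and> res g (e, t, f) = (g, t, f')"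
    and R2: "(e, t, f) \<in> G \<Longrightarrow> res e (e, t, f) = (e, t, f)"
    and R3: "\<lbrakk>(e, t, f) \<in> G; h \<preceq> g; g \<preceq> e\<rbrakk> \<Longrightarrow> res h (res g (e, t, f)) = res h (e, t, f)"
    and R4: "\<And>n e t e'.
      \<lbrakk>2 \<le> n;
       \<forall>i\<in>{1..n}. (e (i - 1), t i, e i) \<in> G;
       (e 0, word_prod T t n, e n) \<in> G;
       e' 0 \<preceq> e 0;
       \<forall>i\<in>{1..n}. e' i = tgt (res (e' (i - 1)) (e (i - 1), t i, e i))\<rbrakk>
      \<Longrightarrow> res (e' 0) (e 0, word_prod T t n, e n) = (e' 0, word_prod T t n, e' n)"
    and R5: "f \<preceq> e \<Longrightarrow> res f (e, \<one>, e) = (f, \<one>, f)"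
    and CR1: "\<lbrakk>(e, t, f) \<in> G; g \<preceq> f\<rbrakk> \<Longrightarrow> \<exists>e'. e' \<preceq> e \<and> cor (e, t, f) g = (e', t, g)"
    and CR2: "(e, t, f) \<in> G \<Longrightarrow> cor (e, t, f) f = (e, t, f)"
    and CR3: "\<lbrakk>(e, t, f) \<in> G; h \<preceq> g; g \<preceq> f\<rbrakk> \<Longrightarrow> cor (cor (e, t, f) g) h = cor (e, t, f) h"
    and CR4: "\<And>n e t e'.
      \<lbrakk>2 \<le> n;
       \<forall>i\<in>{1..n}. (e (i - 1), t i, e i) \<in> G;
       (e 0, word_prod T t n, e n) \<in> G;
       e' n \<preceq> e n;
       \<forall>i\<in>{1..n}. e' (i - 1) = src (cor (e (i - 1), t i, e i) (e' i))\<rbrakk>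
      \<Longrightarrow> cor (e 0, word_prod T t n, e n) (e' n) = (e' 0, word_prod T t n, e' n)"
    and CR5: "f \<preceq> e \<Longrightarrow> cor (e, \<one>, e) f = (f, \<one>, f)"
    and C: "\<lbrakk>(e, t, f) \<in> G; c = (e, t, f); g \<preceq> e; h \<preceq> f\<rbrakk> \<Longrightarrow>
      cor (res g c) (tgt (res g c) \<^bold>\<sqinter> h) = (g \<^bold>\<sqinter> src (cor c h), t, tgt (res g c) \<^bold>\<sqinter> h) \<and>
      res (src (cor c h) \<^bold>\<sqinter> g) (cor c h) = (g \<^bold>\<sqinter> src (cor c h), t, tgt (res g c) \<^bold>\<sqinter> h)"

definition semidirect ::
  "('t, 'm) monoid_scheme \<Rightarrow> ('e, 't) edge set \<Rightarrow> ('e \<Rightarrow> 'e \<Rightarrow> 'e) \<Rightarrow>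
   ('e \<Rightarrow> ('e, 't) edge \<Rightarrow> ('e, 't) edge) \<Rightarrow> (('e, 't) edge \<Rightarrow> 'e \<Rightarrow> ('e, 't) edge) \<Rightarrow>
   ('e, 't) edge biunary" where
  "semidirect T G wedge res cor =
     \<lparr>carrier = G,
      bmult = (\<lambda>c d. edge_comp T (cor c (wedge (tgt c) (src d))) (res (wedge (tgt c) (src d)) d)),
      bplus = (\<lambda>c. (src c, \<one>\<^bsub>T\<^esub>, src c)),
      bstar = (\<lambda>c. (tgt c, \<one>\<^bsub>T\<^esub>, tgt c))\<rparr>"


section \<open>The graph of a strictly proper Ehresmann semigroup\<close>

definition underlying_graph :: "('a, 'm) biunary_scheme \<Rightarrow> ('a, 'a set) edge set" where
  "underlying_graph S = {(a\<^sup>+\<^bsub>S\<^esub>, sigma_class S a, a\<^sup>*\<^bsub>S\<^esub>) | a. a \<in> carrier S}"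

end

theory Submission
  imports Defs
begin

text \<open>
  For an Ehresmann semigroup \<open>S\<close>, the quotient \<open>S/\<sigma>\<close> is a monoid because \<open>a\<^sup>+ \<cdot> a = a = a \<cdot> a\<^sup>*\<close>:
  every element has some projection as a left identity and some projection as a right identity, and
  \<open>\<sigma>\<close> identifies all projections.

  In the second part, a composable pair of edges of the graph of \<open>S\<close> comes from \<open>a, b\<close> with
  \<open>a\<^sup>* = b\<^sup>+\<close>. The axiom \<open>(x y)\<^sup>+ = (x y\<^sup>+)\<^sup>+\<close> then gives \<open>(a b)\<^sup>+ = (a a\<^sup>*)\<^sup>+ = a\<^sup>+\<close>, and dually
  \<open>(a b)\<^sup>* = b\<^sup>*\<close>, so the composite edge is the one that comes from \<open>a b\<close>.

  In the first part, the substance is that the semidirect product is an Ehresmann semigroup at all,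
  and there only associativity takes work. In a product \<open>c \<cdot> d \<cdot> k\<close> the label is clear and
  only the end points have to be compared. With \<open>m = tgt c \<sqinter> src d\<close> and \<open>n = tgt d \<sqinter> src k\<close>, one
  bracketing first restricts \<open>d\<close> to \<open>m\<close> and then corestricts, the other first corestricts
  \<open>d\<close> to \<open>n\<close> and then restricts. Axiom \<open>C\<close> says that these give the same edge, and the axioms for
  restriction along a path of two edges (\<open>R4\<close>, \<open>CR4\<close>) and for repeated restriction (\<open>R3\<close>, \<open>CR3\<close>)
  carry the equality of the middle edges over to both ends.
  An edge is the triple of its source, label and target; the operations \<open>\<^sup>+\<close> and \<open>\<^sup>*\<close> record source and
  target, and by hypothesis \<open>\<sigma>\<close> records the label. Hence the product is strictly proper,
  and the label map induces the isomorphism of the quotient with \<open>T\<close>.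
\<close>

section \<open>The quotient of an Ehresmann semigroup by \<open>\<sigma>\<close>\<close>

context ehresmann_semigroup
begin

lemma sigma_is_congruence: "is_congruence S (sigma S)"
proof -
  let ?R = "{\<rho>. is_congruence S \<rho> \<and> projections S \<times> projections S \<subseteq> \<rho>}"
  \<comment> \<open>The universal congruence shows that the intersection defining \<open>\<sigma>\<close> is not over the empty family.\<close>
  have full: "carrier S \<times> carrier S \<in> ?R"
    using mult_closed plus_closed star_closed
    by (auto simp: is_congruence_def projections_def equiv_def refl_on_def sym_on_def trans_def)
  have equiv: "equiv (carrier S) (sigma S)"
  proof (rule equivI)
    show "sigma S \<subseteq> carrier S \<times> carrier S"
      using full unfolding sigma_def by blast
    show "refl_on (carrier S) (sigma S)"
      unfolding sigma_def is_congruence_def equiv_def refl_on_def by blast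
    show "sym (sigma S)"
      unfolding sigma_def is_congruence_def equiv_def sym_on_def by blast
    show "trans (sigma S)"
      unfolding sigma_def is_congruence_def equiv_def
      by (rule transI) (blast dest: transD)
  qed
  have mem: "(x, y) \<in> sigma S \<longleftrightarrow> (\<forall>\<rho>\<in>?R. (x, y) \<in> \<rho>)" for x y
    by (simp add: sigma_def)
  have "(a \<cdot> c, b \<cdot> d) \<in> sigma S" if ab: "(a, b) \<in> sigma S" and cd: "(c, d) \<in> sigma S" for a b c d
    unfolding mem
  proof
    fix \<rho> assume \<rho>: "\<rho> \<in> ?R"
    then have "(a, b) \<in> \<rho>" "(c, d) \<in> \<rho>" using ab cd unfolding mem by auto
    with \<rho> show "(a \<cdot> c, b \<cdot> d) \<in> \<rho>" by (auto simp: is_congruence_def)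
  qed
  moreover have "(a\<^sup>+, b\<^sup>+) \<in> sigma S \<and> (a\<^sup>*, b\<^sup>*) \<in> sigma S" if ab: "(a, b) \<in> sigma S" for a b
    unfolding mem ball_conj_distrib[symmetric]
  proof
    fix \<rho> assume \<rho>: "\<rho> \<in> ?R"
    then have "(a, b) \<in> \<rho>" using ab unfolding mem by auto
    with \<rho> show "(a\<^sup>+, b\<^sup>+) \<in> \<rho> \<and> (a\<^sup>*, b\<^sup>*) \<in> \<rho>" by (auto simp: is_congruence_def)
  qed
  ultimately show ?thesis
    using equiv by (auto simp: is_congruence_def)
qed

lemma sigma_equiv: "equiv (carrier S) (sigma S)"
  using sigma_is_congruence by (simp add: is_congruence_def)

lemma sigma_mult: "(a, b) \<in> sigma S \<Longrightarrow> (c, d) \<in> sigma S \<Longrightarrow> (a \<cdot> c, b \<cdot> d) \<in> sigma S"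
  using sigma_is_congruence by (auto simp: is_congruence_def)

lemma sigma_projections: "p \<in> projections S \<Longrightarrow> q \<in> projections S \<Longrightarrow> (p, q) \<in> sigma S"
  unfolding sigma_def by blast

lemma sigma_refl: "a \<in> carrier S \<Longrightarrow> (a, a) \<in> sigma S"
  using sigma_equiv by (meson equivE refl_onD)

lemma sigma_class_eq_iff:
  "a \<in> carrier S \<Longrightarrow> b \<in> carrier S \<Longrightarrow> sigma_class S a = sigma_class S b \<longleftrightarrow> (a, b) \<in> sigma S"
  unfolding sigma_class_def using sigma_equiv by (rule eq_equiv_class_iff)

lemma sigma_class_in_quotient: "a \<in> carrier S \<Longrightarrow> sigma_class S a \<in> carrier (sigma_quotient S)"
  by (simp add: sigma_quotient_def sigma_class_def quotientI)

lemma sigma_quotient_cases: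
  assumes "A \<in> carrier (sigma_quotient S)"
  obtains a where "a \<in> carrier S" "A = sigma_class S a"
  using assms by (auto simp: sigma_quotient_def sigma_class_def elim: quotientE)

lemma sigma_class_mult:
  assumes a: "a \<in> carrier S" and b: "b \<in> carrier S"
  shows "sigma_class S a \<otimes>\<^bsub>sigma_quotient S\<^esub> sigma_class S b = sigma_class S (a \<cdot> b)"
proof -
  have same: "sigma_class S (x \<cdot> y) = sigma_class S (a \<cdot> b)"
    if "x \<in> sigma_class S a" "y \<in> sigma_class S b" for x y
  proof -
    have "(a \<cdot> b, x \<cdot> y) \<in> sigma S"
      using that unfolding sigma_class_def by (intro sigma_mult) simp_all
    then show ?thesis
      unfolding sigma_class_def by (rule equiv_class_eq[OF sigma_equiv, symmetric])
  qed
  have "sigma_class S a \<noteq> {}" "sigma_class S b \<noteq> {}"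
    using sigma_refl[OF a] sigma_refl[OF b] unfolding sigma_class_def by blast+
  moreover have "(\<Union>x\<in>sigma_class S a. \<Union>y\<in>sigma_class S b. sigma_class S (x \<cdot> y))
      = (\<Union>x\<in>sigma_class S a. \<Union>y\<in>sigma_class S b. sigma_class S (a \<cdot> b))"
    by (intro SUP_cong refl same)
  ultimately show ?thesis by (simp add: sigma_quotient_def)
qed

lemma plus_in_projections: "a \<in> carrier S \<Longrightarrow> a\<^sup>+ \<in> projections S"
  unfolding projections_def by blast

lemma star_in_projections: "a \<in> carrier S \<Longrightarrow> a\<^sup>* \<in> projections S"
  using plus_in_projections[of "a\<^sup>*"] by (simp add: star_closed plus_of_star)

lemma projections_subset: "projections S \<subseteq> carrier S"
  by (auto simp: projections_def plus_closed)

lemma projection_fixed: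
  assumes "p \<in> projections S" shows "p\<^sup>+ = p" "p\<^sup>* = p"
proof -
  from assms obtain s where s: "s \<in> carrier S" "p = s\<^sup>+" by (auto simp: projections_def)
  then show star: "p\<^sup>* = p" by (simp add: star_of_plus)
  show "p\<^sup>+ = p" using plus_of_star[of p] s plus_closed star by simp
qed

lemma quotient_one:
  assumes p: "p \<in> projections S"
  shows "\<one>\<^bsub>sigma_quotient S\<^esub> = sigma_class S p"
proof -
  have "(\<Union>q\<in>projections S. sigma_class S q) = (\<Union>q\<in>projections S. sigma_class S p)"
    unfolding sigma_class_def
    by (intro SUP_cong refl equiv_class_eq[OF sigma_equiv] sigma_projections p)
  then show ?thesis using p by (auto simp: sigma_quotient_def)
qed

lemma quotient_monoid: "monoid (sigma_quotient S)"
proof (rule monoidI)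
  fix A B assume "A \<in> carrier (sigma_quotient S)" "B \<in> carrier (sigma_quotient S)"
  then show "A \<otimes>\<^bsub>sigma_quotient S\<^esub> B \<in> carrier (sigma_quotient S)"
    by (elim sigma_quotient_cases) (simp add: sigma_class_mult sigma_class_in_quotient mult_closed)
next
  obtain a where "a \<in> carrier S" using nonempty by blast
  then show "\<one>\<^bsub>sigma_quotient S\<^esub> \<in> carrier (sigma_quotient S)"
    by (simp add: quotient_one[OF plus_in_projections] sigma_class_in_quotient plus_closed)
next
  fix A B C
  assume "A \<in> carrier (sigma_quotient S)" "B \<in> carrier (sigma_quotient S)"
    "C \<in> carrier (sigma_quotient S)"
  then show "A \<otimes>\<^bsub>sigma_quotient S\<^esub> B \<otimes>\<^bsub>sigma_quotient S\<^esub> C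
      = A \<otimes>\<^bsub>sigma_quotient S\<^esub> (B \<otimes>\<^bsub>sigma_quotient S\<^esub> C)"
    by (elim sigma_quotient_cases) (simp add: sigma_class_mult mult_closed assoc)
next
  \<comment> \<open>The unit is represented by \<open>a\<^sup>+\<close> on the left of \<open>a\<close> and by \<open>a\<^sup>*\<close> on its right.\<close>
  fix A assume "A \<in> carrier (sigma_quotient S)"
  then obtain a where a: "a \<in> carrier S" and A: "A = sigma_class S a"
    by (rule sigma_quotient_cases)
  show "\<one>\<^bsub>sigma_quotient S\<^esub> \<otimes>\<^bsub>sigma_quotient S\<^esub> A = A"
    by (simp add: a A quotient_one[OF plus_in_projections[OF a]] sigma_class_mult plus_closed plus_left)
  show "A \<otimes>\<^bsub>sigma_quotient S\<^esub> \<one>\<^bsub>sigma_quotient S\<^esub> = A"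
    by (simp add: a A quotient_one[OF star_in_projections[OF a]] sigma_class_mult star_closed star_right)
qed

section \<open>The underlying graph of an Ehresmann semigroup\<close>

lemma underlying_graph_multiaction:
  "partial_multiaction (sigma_quotient S) (projections S) (underlying_graph S)"
proof -
  interpret Q: monoid "sigma_quotient S" by (rule quotient_monoid)
  show ?thesis
  proof
    obtain a where "a \<in> carrier S" using nonempty by blast
    then have "a\<^sup>+ \<in> projections S" by (rule plus_in_projections)
    then show "projections S \<noteq> {}" by blast
  next
    show "underlying_graph S \<subseteq> projections S \<times> carrier (sigma_quotient S) \<times> projections S"
      by (auto simp: underlying_graph_def plus_in_projections star_in_projections sigma_class_in_quotient)
  next
    fix x assume x: "x \<in> projections S"
    then have "x \<in> carrier S" using projections_subset by blast
    then show "(x, \<one>\<^bsub>sigma_quotient S\<^esub>, x) \<in> underlying_graph S"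
      unfolding underlying_graph_def
      using projection_fixed[OF x] quotient_one[OF x] by force
  next
    fix t assume "t \<in> carrier (sigma_quotient S)"
    then show "\<exists>x y. (x, t, y) \<in> underlying_graph S"
      by (elim sigma_quotient_cases) (auto simp: underlying_graph_def)
  next
    fix x t y s z
    assume "(x, t, y) \<in> underlying_graph S" "(y, s, z) \<in> underlying_graph S"
    then obtain a b where a: "a \<in> carrier S" "x = a\<^sup>+" "t = sigma_class S a" "y = a\<^sup>*"
      and b: "b \<in> carrier S" "y = b\<^sup>+" "s = sigma_class S b" "z = b\<^sup>*"
      unfolding underlying_graph_def by blast
    have "(a \<cdot> b)\<^sup>+ = (a \<cdot> a\<^sup>*)\<^sup>+" using a b plus_mult by metis
    then have p: "(a \<cdot> b)\<^sup>+ = x" using a star_right by simp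
    have "(a \<cdot> b)\<^sup>* = (b\<^sup>+ \<cdot> b)\<^sup>*" using a b star_mult by metis
    then have q: "(a \<cdot> b)\<^sup>* = z" using b plus_left by simp
    have "t \<otimes>\<^bsub>sigma_quotient S\<^esub> s = sigma_class S (a \<cdot> b)"
      using a b by (simp add: sigma_class_mult)
    then show "(x, t \<otimes>\<^bsub>sigma_quotient S\<^esub> s, z) \<in> underlying_graph S"
      unfolding underlying_graph_def using p q a b mult_closed by blast
  qed
qed

end

section \<open>The semidirect product is an Ehresmann semigroup\<close>

context semilattice_on
begin

lemma meet_below_left: "e \<in> E \<Longrightarrow> f \<in> E \<Longrightarrow> wedge e f \<preceq> e"
  unfolding below_def by (metis meet_assoc meet_closed meet_comm meet_idem)

lemma meet_below_right: "e \<in> E \<Longrightarrow> f \<in> E \<Longrightarrow> wedge e f \<preceq> f"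
  unfolding below_def by (metis meet_assoc meet_closed meet_idem)

lemma below_refl: "e \<in> E \<Longrightarrow> e \<preceq> e"
  unfolding below_def by (simp add: meet_idem)

lemma belowD: "e \<preceq> f \<Longrightarrow> e \<in> E" "e \<preceq> f \<Longrightarrow> f \<in> E" "e \<preceq> f \<Longrightarrow> wedge f e = e"
  unfolding below_def by (auto simp: meet_comm)

lemma meet_absorb:
  assumes "e \<preceq> f" "g \<in> E" shows "wedge e (wedge f g) = wedge e g"
  using assms unfolding below_def by (metis meet_assoc)

end

lemma edge_simps [simp]: "src (e, t, f) = e" "lab (e, t, f) = t" "tgt (e, t, f) = f"
  by (simp_all add: src_def lab_def tgt_def)

lemma edge_eqI: "src c = src d \<Longrightarrow> lab c = lab d \<Longrightarrow> tgt c = tgt d \<Longrightarrow> c = d"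
  by (simp add: src_def lab_def tgt_def prod_eq_iff)

context compatible_multiaction
begin

abbreviation SD :: "('e, 'a) edge biunary" where "SD \<equiv> semidirect T G wedge res cor"

lemma semidirect_simps [simp]:
  "carrier SD = G"
  "bplus SD c = (src c, \<one>, src c)"
  "bstar SD c = (tgt c, \<one>, tgt c)"
  by (simp_all add: semidirect_def)

lemma semidirect_mult:
  "bmult SD c d = (src (cor c (tgt c \<^bold>\<sqinter> src d)),
     lab (cor c (tgt c \<^bold>\<sqinter> src d)) \<otimes> lab (res (tgt c \<^bold>\<sqinter> src d) d),
     tgt (res (tgt c \<^bold>\<sqinter> src d) d))"
  by (simp add: semidirect_def edge_comp_def)

lemma edge_components: "(e, t, f) \<in> G \<Longrightarrow> e \<in> E \<and> t \<in> carrier T \<and> f \<in> E"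
  using edges by blast

lemma res_form:
  assumes "(e, t, f) \<in> G" "g \<preceq> e"
  obtains f' where "f' \<preceq> f" "res g (e, t, f) = (g, t, f')" "(g, t, f') \<in> G"
  using R1[OF assms] res_edge[OF assms(1)] assms(2) by (metis edge_simps(1))

lemma cor_form:
  assumes "(e, t, f) \<in> G" "h \<preceq> f"
  obtains e' where "e' \<preceq> e" "cor (e, t, f) h = (e', t, h)" "(e', t, h) \<in> G"
  using CR1[OF assms] cor_edge[OF assms(1)] assms(2) by (metis edge_simps(3))

lemma word_prod_two:
  assumes "t 1 \<in> carrier T" "t 2 \<in> carrier T"
  shows "word_prod T t 2 = t 1 \<otimes> t 2"
  using assms by (simp add: word_prod_def upt_rec numeral_2_eq_2)

lemma path_of_two: "{1..2} = {1, 2::nat}"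
  by auto

text \<open>
  This and its dual below are \<open>R4\<close> and \<open>CR4\<close> for \<open>n = 2\<close>, the only path length that a product of two factors
  produces.
\<close>

lemma res_two:
  assumes c: "(x, t, y) \<in> G" and d: "(y, s, z) \<in> G" and g: "g \<preceq> x"
  shows "res g (x, t \<otimes> s, z) = (g, t \<otimes> s, tgt (res (tgt (res g (x, t, y))) (y, s, z)))"
proof -
  let ?e = "\<lambda>i::nat. if i = 0 then x else if i = 1 then y else z"
  let ?t = "\<lambda>i::nat. if i = 1 then t else s"
  let ?v = "tgt (res g (x, t, y))"
  let ?e' = "\<lambda>i::nat. if i = 0 then g else if i = 1 then ?v else tgt (res ?v (y, s, z))"
  have w: "word_prod T ?t 2 = t \<otimes> s"
    using word_prod_two[of ?t] edge_components[OF c] edge_components[OF d] by simp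
  show ?thesis
    using R4[of 2 ?e ?t ?e'] c d g edges_compose[OF c d]
    unfolding path_of_two w by simp
qed

lemma cor_two:
  assumes c: "(x, t, y) \<in> G" and d: "(y, s, z) \<in> G" and h: "h \<preceq> z"
  shows "cor (x, t \<otimes> s, z) h = (src (cor (x, t, y) (src (cor (y, s, z) h))), t \<otimes> s, h)"
proof -
  let ?e = "\<lambda>i::nat. if i = 0 then x else if i = 1 then y else z"
  let ?t = "\<lambda>i::nat. if i = 1 then t else s"
  let ?v = "src (cor (y, s, z) h)"
  let ?e' = "\<lambda>i::nat. if i = 0 then src (cor (x, t, y) ?v) else if i = 1 then ?v else h"
  have w: "word_prod T ?t 2 = t \<otimes> s"
    using word_prod_two[of ?t] edge_components[OF c] edge_components[OF d] by simp
  show ?thesis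
    using CR4[of 2 ?e ?t ?e'] c d h edges_compose[OF c d]
    unfolding path_of_two w by simp
qed

text \<open>
  The two factors in the definition of the product meet at the vertex \<open>f \<sqinter> g\<close>, which is why they
  are composable.
\<close>

lemma mult_form:
  assumes c: "(e, t, f) \<in> G" and d: "(g, s, h) \<in> G"
  obtains a b where "a \<preceq> e" "b \<preceq> h"
    "cor (e, t, f) (f \<^bold>\<sqinter> g) = (a, t, f \<^bold>\<sqinter> g)" "(a, t, f \<^bold>\<sqinter> g) \<in> G"
    "res (f \<^bold>\<sqinter> g) (g, s, h) = (f \<^bold>\<sqinter> g, s, b)" "(f \<^bold>\<sqinter> g, s, b) \<in> G"
    "bmult SD (e, t, f) (g, s, h) = (a, t \<otimes> s, b)" "(a, t \<otimes> s, b) \<in> G"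
proof -
  have fg: "f \<in> E" "g \<in> E" using edge_components c d by auto
  obtain a where a: "a \<preceq> e" "cor (e, t, f) (f \<^bold>\<sqinter> g) = (a, t, f \<^bold>\<sqinter> g)" "(a, t, f \<^bold>\<sqinter> g) \<in> G"
    using cor_form[OF c meet_below_left[OF fg]] by blast
  obtain b where b: "b \<preceq> h" "res (f \<^bold>\<sqinter> g) (g, s, h) = (f \<^bold>\<sqinter> g, s, b)" "(f \<^bold>\<sqinter> g, s, b) \<in> G"
    using res_form[OF d meet_below_right[OF fg]] by blast
  show thesis
    by (rule that[OF a(1) b(1) a(2,3) b(2,3)]) (simp_all add: semidirect_mult a b edges_compose[OF a(3) b(3)])
qed

lemma lab_mult: "c \<in> G \<Longrightarrow> d \<in> G \<Longrightarrow> lab (bmult SD c d) = lab c \<otimes> lab d"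
  by (cases c; cases d) (metis edge_simps(2) mult_form)

lemma projection_mult:
  assumes "e \<in> E" "f \<in> E"
  shows "bmult SD (e, \<one>, e) (f, \<one>, f) = (e \<^bold>\<sqinter> f, \<one>, e \<^bold>\<sqinter> f)"
  using assms by (simp add: semidirect_mult R5 CR5 meet_below_left meet_below_right)

text \<open>
  Let \<open>c, d, k\<close> be the three edges, \<open>b\<close> the target of \<open>d\<close> restricted to \<open>f \<sqinter> g\<close>, and \<open>p\<close> the
  source of \<open>d\<close> corestricted to \<open>h \<sqinter> u\<close>. By \<open>C\<close>, doing both to \<open>d\<close>, in either order, gives the
  edge \<open>(f \<sqinter> p, s, b \<sqinter> u)\<close>. Hence both bracketings have source \<open>src (cor c (f \<sqinter> p))\<close> and target
  \<open>tgt (res (b \<sqinter> u) k)\<close>.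
\<close>

lemma semidirect_assoc:
  assumes c: "(e, t, f) \<in> G" and d: "(g, s, h) \<in> G" and k: "(u, r, v) \<in> G"
  shows "bmult SD (bmult SD (e, t, f) (g, s, h)) (u, r, v)
    = bmult SD (e, t, f) (bmult SD (g, s, h) (u, r, v))"
proof -
  have E: "f \<in> E" "g \<in> E" "h \<in> E" "u \<in> E"
    and T: "t \<in> carrier T" "s \<in> carrier T" "r \<in> carrier T"
    using edge_components c d k by auto
  obtain a b where ab: "a \<preceq> e" "b \<preceq> h"
    "cor (e, t, f) (f \<^bold>\<sqinter> g) = (a, t, f \<^bold>\<sqinter> g)" "(a, t, f \<^bold>\<sqinter> g) \<in> G"
    "res (f \<^bold>\<sqinter> g) (g, s, h) = (f \<^bold>\<sqinter> g, s, b)" "(f \<^bold>\<sqinter> g, s, b) \<in> G"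
    "bmult SD (e, t, f) (g, s, h) = (a, t \<otimes> s, b)" "(a, t \<otimes> s, b) \<in> G"
    using mult_form[OF c d] by blast
  obtain p q where pq: "p \<preceq> g" "q \<preceq> v"
    "cor (g, s, h) (h \<^bold>\<sqinter> u) = (p, s, h \<^bold>\<sqinter> u)" "(p, s, h \<^bold>\<sqinter> u) \<in> G"
    "res (h \<^bold>\<sqinter> u) (u, r, v) = (h \<^bold>\<sqinter> u, r, q)" "(h \<^bold>\<sqinter> u, r, q) \<in> G"
    "bmult SD (g, s, h) (u, r, v) = (p, s \<otimes> r, q)" "(p, s \<otimes> r, q) \<in> G"
    using mult_form[OF d k] by blast
  have bE: "b \<in> E" and pE: "p \<in> E" using ab(2) pq(1) belowD by auto
  have bu: "b \<^bold>\<sqinter> (h \<^bold>\<sqinter> u) = b \<^bold>\<sqinter> u" by (rule meet_absorb[OF ab(2) E(4)])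
  have fp: "f \<^bold>\<sqinter> g \<^bold>\<sqinter> p = f \<^bold>\<sqinter> p"
    using E pE belowD(3)[OF pq(1)] by (simp add: meet_assoc)
  have pf: "p \<^bold>\<sqinter> (f \<^bold>\<sqinter> g) = f \<^bold>\<sqinter> p"
    using fp E pE meet_comm meet_closed by metis
  have middle: "cor (f \<^bold>\<sqinter> g, s, b) (b \<^bold>\<sqinter> u) = (f \<^bold>\<sqinter> p, s, b \<^bold>\<sqinter> u)"
      "res (f \<^bold>\<sqinter> p) (p, s, h \<^bold>\<sqinter> u) = (f \<^bold>\<sqinter> p, s, b \<^bold>\<sqinter> u)"
    using C[OF d refl meet_below_right[OF E(1,2)] meet_below_left[OF E(3,4)]]
    by (simp_all add: ab(5) pq(3) bu fp pf)
  have le_fp: "f \<^bold>\<sqinter> p \<preceq> f \<^bold>\<sqinter> g"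
    using fp meet_below_left[OF meet_closed[OF E(1,2)] pE] by simp
  have le_bu: "b \<^bold>\<sqinter> u \<preceq> h \<^bold>\<sqinter> u"
    using bu meet_below_right[OF bE meet_closed[OF E(3,4)]] by simp
  \<comment> \<open>Corestricting the composite \<open>c \<cdot> d\<close> passes through the middle vertex \<open>f \<sqinter> p\<close>; on the first
     factor, the two successive corestrictions to \<open>f \<sqinter> g\<close> and \<open>f \<sqinter> p\<close> collapse to the second.\<close>
  have left: "src (cor (a, t \<otimes> s, b) (b \<^bold>\<sqinter> u)) = src (cor (e, t, f) (f \<^bold>\<sqinter> p))"
    using cor_two[OF ab(4,6) meet_below_left[OF bE E(4)]]
      CR3[OF c le_fp meet_below_left[OF E(1,2)]]
    by (simp add: middle ab(3))
  have right: "tgt (res (f \<^bold>\<sqinter> p) (p, s \<otimes> r, q)) = tgt (res (b \<^bold>\<sqinter> u) (u, r, v))"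
    using res_two[OF pq(4,6) meet_below_right[OF E(1) pE]]
      R3[OF k le_bu meet_below_right[OF E(3,4)]]
    by (simp add: middle pq(5))
  show ?thesis
  proof (rule edge_eqI)
    show "lab (bmult SD (bmult SD (e, t, f) (g, s, h)) (u, r, v))
      = lab (bmult SD (e, t, f) (bmult SD (g, s, h) (u, r, v)))"
      using lab_mult[OF ab(8) k] lab_mult[OF c pq(8)] T by (simp add: ab(7) pq(7) m_assoc)
  qed (simp_all add: ab(3,5) pq(3,5) semidirect_mult left right)
qed

lemma semidirect_ehresmann: "ehresmann_semigroup SD"
proof
  show "carrier SD \<noteq> {}"
    using vertices_nonempty identity_edge by auto
next
  fix x y z assume "x \<in> carrier SD" "y \<in> carrier SD" "z \<in> carrier SD"
  then show "bmult SD (bmult SD x y) z = bmult SD x (bmult SD y z)"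
    by (cases x; cases y; cases z) (simp add: semidirect_assoc)
next
  fix x assume "x \<in> carrier SD"
  then obtain e t f where x: "x = (e, t, f)" "(e, t, f) \<in> G" by (cases x) auto
  have m: "e \<in> E" "t \<in> carrier T" "f \<in> E" using edge_components[OF x(2)] by auto
  show "bplus SD x \<in> carrier SD" "bstar SD x \<in> carrier SD"
    using m identity_edge by (auto simp: x(1))
  show "bmult SD (bplus SD x) x = x" "bmult SD x (bstar SD x) = x"
    using m x(2) by (simp_all add: x(1) semidirect_mult meet_idem R2 CR2 R5 CR5 below_refl)
  show "bstar SD (bplus SD x) = bplus SD x" "bplus SD (bstar SD x) = bstar SD x"
    by simp_all
next
  fix x y assume "x \<in> carrier SD" "y \<in> carrier SD"
  then obtain e t f g s h where x: "x = (e, t, f)" "(e, t, f) \<in> G" and y: "y = (g, s, h)" "(g, s, h) \<in> G"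
    by (cases x; cases y) auto
  have m: "e \<in> E" "f \<in> E" "g \<in> E" "h \<in> E"
    using edge_components[OF x(2)] edge_components[OF y(2)] by auto
  show "bmult SD x y \<in> carrier SD"
    using mult_form[OF x(2) y(2)] by (metis x(1) y(1) semidirect_simps(1))
  show "bplus SD (bmult SD (bplus SD x) (bplus SD y)) = bmult SD (bplus SD x) (bplus SD y)"
    "bmult SD (bplus SD x) (bplus SD y) = bmult SD (bplus SD y) (bplus SD x)"
    "bstar SD (bmult SD (bstar SD x) (bstar SD y)) = bmult SD (bstar SD x) (bstar SD y)"
    "bmult SD (bstar SD x) (bstar SD y) = bmult SD (bstar SD y) (bstar SD x)"
    using m by (simp_all add: x(1) y(1) projection_mult meet_comm)
  show "bplus SD (bmult SD x y) = bplus SD (bmult SD x (bplus SD y))"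
    "bstar SD (bmult SD x y) = bstar SD (bmult SD (bstar SD x) y)"
    by (simp_all add: semidirect_mult)
qed

section \<open>The label map\<close>

lemma semidirect_strictly_proper:
  assumes sig: "\<And>c d. c \<in> G \<Longrightarrow> d \<in> G \<Longrightarrow> (c, d) \<in> sigma SD \<longleftrightarrow> lab c = lab d"
  shows "strictly_proper_ehresmann_semigroup SD"
proof -
  interpret S: ehresmann_semigroup SD by (rule semidirect_ehresmann)
  show ?thesis
    by unfold_locales (auto simp: proper_def sig intro: edge_eqI)
qed

lemma label_iso:
  assumes sig: "\<And>c d. c \<in> G \<Longrightarrow> d \<in> G \<Longrightarrow> (c, d) \<in> sigma SD \<longleftrightarrow> lab c = lab d"
  obtains \<phi> where "\<phi> \<in> iso (sigma_quotient SD) T" "\<phi> \<one>\<^bsub>sigma_quotient SD\<^esub> = \<one>"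
    "\<And>c. c \<in> G \<Longrightarrow> \<phi> (sigma_class SD c) = lab c"
proof -
  interpret S: ehresmann_semigroup SD by (rule semidirect_ehresmann)
  \<comment> \<open>Any representative may be chosen, as labels are constant on \<open>\<sigma>\<close>-classes.\<close>
  define \<phi> where "\<phi> A = lab (SOME c. c \<in> A)" for A :: "('e, 'a) edge set"
  have val: "\<phi> (sigma_class SD c) = lab c" if c: "c \<in> G" for c
  proof -
    have "c \<in> sigma_class SD c"
      using S.sigma_refl c by (simp add: sigma_class_def)
    then have "(SOME d. d \<in> sigma_class SD c) \<in> sigma_class SD c"
      by (rule someI)
    then have r: "(c, SOME d. d \<in> sigma_class SD c) \<in> sigma SD"
      by (simp add: sigma_class_def)
    moreover from r have "(SOME d. d \<in> sigma_class SD c) \<in> G"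
      using S.sigma_equiv by (auto simp: equiv_def)
    ultimately show ?thesis
      using sig[OF c] by (simp add: \<phi>_def)
  qed
  have labT: "lab c \<in> carrier T" if "c \<in> G" for c
    using that edge_components by (cases c) auto
  have closed: "\<phi> A \<in> carrier T" if "A \<in> carrier (sigma_quotient SD)" for A
    using that by (rule S.sigma_quotient_cases) (simp add: val labT)
  have "\<phi> \<in> hom (sigma_quotient SD) T"
  proof (rule homI)
    fix A B assume "A \<in> carrier (sigma_quotient SD)" "B \<in> carrier (sigma_quotient SD)"
    then show "\<phi> (A \<otimes>\<^bsub>sigma_quotient SD\<^esub> B) = \<phi> A \<otimes> \<phi> B"
      by (elim S.sigma_quotient_cases)
        (simp add: S.sigma_class_mult val lab_mult S.mult_closed[simplified])
  qed (rule closed)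
  moreover have "inj_on \<phi> (carrier (sigma_quotient SD))"
    by (rule inj_onI, elim S.sigma_quotient_cases) (simp add: val sig S.sigma_class_eq_iff)
  moreover have "\<phi> ` carrier (sigma_quotient SD) = carrier T"
  proof
    show "\<phi> ` carrier (sigma_quotient SD) \<subseteq> carrier T"
      using closed by blast
    show "carrier T \<subseteq> \<phi> ` carrier (sigma_quotient SD)"
    proof
      fix t assume "t \<in> carrier T"
      then obtain x y where c: "(x, t, y) \<in> G" using label_occurs by blast
      then show "t \<in> \<phi> ` carrier (sigma_quotient SD)"
        using S.sigma_class_in_quotient[of "(x, t, y)"] val[OF c] c
        by (intro image_eqI[of _ _ "sigma_class SD (x, t, y)"]) simp_all
    qed
  qed
  ultimately have iso: "\<phi> \<in> iso (sigma_quotient SD) T"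
    by (simp add: iso_def bij_betw_def)
  obtain c where c: "c \<in> G" using S.nonempty by auto
  have one: "\<phi> \<one>\<^bsub>sigma_quotient SD\<^esub> = \<one>"
    using S.quotient_one[OF S.plus_in_projections[of c]] val[OF S.plus_closed[of c, simplified]] c by simp
  show thesis by (rule that[OF iso one val])
qed

end

theorem proposition6p7:
  fixes T :: "('t, 'm) monoid_scheme" and E :: "'e set" and G :: "('e, 't) edge set"
    and wedge :: "'e \<Rightarrow> 'e \<Rightarrow> 'e"
    and res :: "'e \<Rightarrow> ('e, 't) edge \<Rightarrow> ('e, 't) edge"
    and cor :: "('e, 't) edge \<Rightarrow> 'e \<Rightarrow> ('e, 't) edge"
    and S :: "('s, 'n) biunary_scheme"
  shows
    "(compatible_multiaction T E G wedge res cor \<and>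
      (\<forall>c \<in> carrier (semidirect T G wedge res cor). \<forall>d \<in> carrier (semidirect T G wedge res cor).
         (c, d) \<in> sigma (semidirect T G wedge res cor) \<longleftrightarrow> lab c = lab d)
      \<longrightarrow>
      strictly_proper_ehresmann_semigroup (semidirect T G wedge res cor) \<and>
      monoid (sigma_quotient (semidirect T G wedge res cor)) \<and>
      (\<exists>\<phi> \<in> iso (sigma_quotient (semidirect T G wedge res cor)) T.
         \<phi> \<one>\<^bsub>sigma_quotient (semidirect T G wedge res cor)\<^esub> = \<one>\<^bsub>T\<^esub> \<and>
         (\<forall>(e, s, f) \<in> G. \<phi> (sigma_class (semidirect T G wedge res cor) (e, s, f)) = s)))
     \<and>
     (strictly_proper_ehresmann_semigroup S \<longrightarrow>
      partial_multiaction (sigma_quotient S) (projections S) (underlying_graph S))"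
proof ((rule conjI; rule impI), goal_cases)
  case 1
  then interpret compatible_multiaction T E G wedge res cor by blast
  have sig: "\<And>c d. c \<in> G \<Longrightarrow> d \<in> G \<Longrightarrow> (c, d) \<in> sigma SD \<longleftrightarrow> lab c = lab d"
    using 1 by simp
  obtain \<phi> where \<phi>: "\<phi> \<in> iso (sigma_quotient SD) T" "\<phi> \<one>\<^bsub>sigma_quotient SD\<^esub> = \<one>\<^bsub>T\<^esub>"
    "\<And>c. c \<in> G \<Longrightarrow> \<phi> (sigma_class SD c) = lab c"
    using label_iso[OF sig] by blast
  have "\<forall>(e, s, f) \<in> G. \<phi> (sigma_class SD (e, s, f)) = s"
    using \<phi>(3) by auto
  with \<phi> have "\<exists>\<phi> \<in> iso (sigma_quotient SD) T. \<phi> \<one>\<^bsub>sigma_quotient SD\<^esub> = \<one>\<^bsub>T\<^esub> \<and>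
      (\<forall>(e, s, f) \<in> G. \<phi> (sigma_class SD (e, s, f)) = s)"
    by blast
  then show ?case
    using semidirect_strictly_proper[OF sig]
      ehresmann_semigroup.quotient_monoid[OF semidirect_ehresmann] by blast
next
  case 2
  then interpret strictly_proper_ehresmann_semigroup S .
  show ?case by (rule underlying_graph_multiaction)
qed

end
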